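(* Let $A$ be a non-degenerate evolution $\mathbb{K}$-algebra with natural basis $B$ and associated directed graph $E$ relative to $B$. Let $\mathcal{H}$ be the set of hereditary subsets of $E^0=B$, $\mathcal{I}$ the set of ideals of $A$, $\mathcal{H}^*\subset\mathcal{H}$ the set of hereditary and saturated subsets of $E^0$, and $\mathcal{I}^*\subset\mathcal{I}$ the set of ideals of $A$ having the absorption property, all ordered by inclusion. Let $\mathfrak{f}:\mathcal{H}\to\mathcal{I}$, $H\mapsto I_H$, and $\mathfrak{h}:\mathcal{I}\to\mathcal{H}$, $I\mapsto H_I$. Then: (1) The restrictions $\mathfrak{f}:\mathcal{H}^*\to\mathcal{I}^*$ and $\mathfrak{h}:\mathcal{I}^*\to\mathcal{H}^*$ are a monotone Galois connection. (2) If $H_i\in\mathcal{H}^*$ for all $i\in\Gamma$ and $\bigcup_{i\in\Gamma}H_i\in\mathcal{H}^*$, then $I_{\bigcup_{i\in\Gamma}H_i}=\sum_{i\in\Gamma}I_{H_i}$. (3) If $\{I_i\}_{i\in\Omega}$ is a collection of ideals having the absorption property, then $H_{\bigcap_{i\in\Omega}I_i}=\bigcap_{i\in\Omega}H_{I_i}$. (4) If $A$ is finite-dimensional with $A=A^2$, then $\mathfrak{f},\mathfrak{h}$ is a monotone Galois connection between $(\mathcal{H},\subset)$ and $(\mathcal{I},\subset)$.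
   Context: An evolution algebra over a field $\mathbb{K}$ is a (not necessarily associative or finite-dimensional) $\mathbb{K}$-algebra $A$ having a basis $B=\{e_i\}_{i\in\Lambda}$, called a natural basis, with $e_ie_j=0$ whenever $i\neq j$. $A$ is non-degenerate if $\{x\in A: xA=0\}=0$ (equivalently $e_i^2\neq 0$ for all $i$). $A^2$ is the linear span of all products. The associated directed graph $E$ relative to $B$ has vertex set $E^0=B$ and exactly one edge from $e_i$ to $e_j$ if the coefficient of $e_j$ in $e_i^2$ is nonzero, and no edge otherwise; $s(f)$, $r(f)$ denote the source and range of an edge $f$. A subset $H\subset E^0$ is hereditary if, for every $u\in H$, every vertex reachable from $u$ by a directed path belongs to $H$. A vertex $u$ is regular if $0<|s^{-1}(u)|<\infty$. $H$ is saturated if for every regular vertex $u\in E^0$, $r(s^{-1}(u))\subset H$ implies $u\in H$. For an ideal $I$ of $A$, $H_I:=\{e_i\in B: e_i^2\in I\}$ (a hereditary set). For a hereditary $H$, $I_H:=\operatorname{span}(H)$ (an ideal of $A$), with $I_\emptyset=\{0\}$. An ideal $I$ of $A$ has the absorption property if $xA\subset I$ implies $x\in I$. For partially ordered sets $(P,\le)$, $(Q,\le)$, functions $F:P\to Q$ and $G:Q\to P$ form a Galois connection (with $F$ the left adjoint and $G$ the right adjoint) if for all $p\in P$, $q\in Q$: $F(p)\le q$ if and only if $p\le G(q)$; it is monotone if $F$ and $G$ are monotone (order preserving). Here $\mathfrak{f}$ is the left adjoint and $\mathfrak{h}$ the right adjoint. *)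

theory Defs
  imports
    "HOL-Algebra.Galois_Connection"
    "Graph_Theory.Digraph"
begin

text \<open>The algebra is the whole type \<open>'a\<close>. The product is only required to be bilinear, and no
  bound on the dimension is imposed.\<close>

locale nonassociative_algebra = vector_space scale
  for scale :: "'k::field \<Rightarrow> 'a::ab_group_add \<Rightarrow> 'a" (infixr \<open>*s\<close> 75) +
  fixes mult :: "'a \<Rightarrow> 'a \<Rightarrow> 'a" (infixl \<open>\<bullet>\<close> 70)
  assumes linear_mult_right: "\<And>x. Vector_Spaces.linear (*s) (*s) (\<lambda>y. x \<bullet> y)"
    and linear_mult_left: "\<And>y. Vector_Spaces.linear (*s) (*s) (\<lambda>x. x \<bullet> y)"

locale evolution_algebra = nonassociative_algebra scale mult
  for scale :: "'k::field \<Rightarrow> 'a::ab_group_add \<Rightarrow> 'a" (infixr \<open>*s\<close> 75)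
    and mult :: "'a \<Rightarrow> 'a \<Rightarrow> 'a" (infixl \<open>\<bullet>\<close> 70) +
  fixes B :: "'a set"
  assumes independent_basis: "independent B"
    and span_basis: "span B = UNIV"
    and natural_basis: "\<And>e e'. \<lbrakk>e \<in> B; e' \<in> B; e \<noteq> e'\<rbrakk> \<Longrightarrow> e \<bullet> e' = 0"

definition nondegenerate :: "('a::ab_group_add \<Rightarrow> 'a \<Rightarrow> 'a) \<Rightarrow> bool" where
  "nondegenerate mult \<longleftrightarrow> {x. \<forall>a. mult x a = 0} = {0}"

definition algebra_ideal ::
    "('k::field \<Rightarrow> 'a::ab_group_add \<Rightarrow> 'a) \<Rightarrow> ('a \<Rightarrow> 'a \<Rightarrow> 'a) \<Rightarrow> 'a set \<Rightarrow> bool" where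
  "algebra_ideal scale mult I \<longleftrightarrow>
     module.subspace scale I \<and> (\<forall>x\<in>I. \<forall>a. mult x a \<in> I \<and> mult a x \<in> I)"

definition absorption :: "('a \<Rightarrow> 'a \<Rightarrow> 'a) \<Rightarrow> 'a set \<Rightarrow> bool" where
  "absorption mult I \<longleftrightarrow> (\<forall>x. range (mult x) \<subseteq> I \<longrightarrow> x \<in> I)"

definition algebra_square ::
    "('k::field \<Rightarrow> 'a::ab_group_add \<Rightarrow> 'a) \<Rightarrow> ('a \<Rightarrow> 'a \<Rightarrow> 'a) \<Rightarrow> 'a set" where
  "algebra_square scale mult = module.span scale {mult x y | x y. True}"

definition finite_dimensional :: "('k::field \<Rightarrow> 'a::ab_group_add \<Rightarrow> 'a) \<Rightarrow> bool" where
  "finite_dimensional scale \<longleftrightarrow> (\<exists>S. finite S \<and> module.span scale S = UNIV)"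

definition sum_of_family :: "'i set \<Rightarrow> ('i \<Rightarrow> 'a::comm_monoid_add set) \<Rightarrow> 'a set" where
  "sum_of_family \<Gamma> J = {\<Sum>i\<in>F. x i | F x. finite F \<and> F \<subseteq> \<Gamma> \<and> (\<forall>i\<in>F. x i \<in> J i)}"

text \<open>There is at most one edge between two vertices, so edges are pairs of vertices.
  The coefficient of \<open>v\<close> in the square of \<open>u\<close> is read off with \<open>representation\<close>.\<close>

definition associated_graph ::
    "('k::field \<Rightarrow> 'a::ab_group_add \<Rightarrow> 'a) \<Rightarrow> ('a \<Rightarrow> 'a \<Rightarrow> 'a) \<Rightarrow> 'a set \<Rightarrow> ('a, 'a \<times> 'a) pre_digraph" where
  "associated_graph scale mult B =
     \<lparr> verts = B,
       arcs = {(u, v). u \<in> B \<and> v \<in> B \<and> module.representation scale B (mult u u) v \<noteq> 0},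
       tail = fst, head = snd \<rparr>"

definition hereditary :: "('v, 'e) pre_digraph \<Rightarrow> 'v set \<Rightarrow> bool" where
  "hereditary E H \<longleftrightarrow> H \<subseteq> verts E \<and> (\<forall>u\<in>H. \<forall>v. u \<rightarrow>\<^sup>*\<^bsub>E\<^esub> v \<longrightarrow> v \<in> H)"

definition regular_vertex :: "('v, 'e) pre_digraph \<Rightarrow> 'v \<Rightarrow> bool" where
  "regular_vertex E u \<longleftrightarrow> u \<in> verts E \<and> out_arcs E u \<noteq> {} \<and> finite (out_arcs E u)"

definition saturated :: "('v, 'e) pre_digraph \<Rightarrow> 'v set \<Rightarrow> bool" where
  "saturated E H \<longleftrightarrow> (\<forall>u. regular_vertex E u \<longrightarrow> head E ` out_arcs E u \<subseteq> H \<longrightarrow> u \<in> H)"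

definition hereditary_sets ::
    "('k::field \<Rightarrow> 'a::ab_group_add \<Rightarrow> 'a) \<Rightarrow> ('a \<Rightarrow> 'a \<Rightarrow> 'a) \<Rightarrow> 'a set \<Rightarrow> 'a set set" where
  "hereditary_sets scale mult B = {H. hereditary (associated_graph scale mult B) H}"

definition hereditary_saturated_sets ::
    "('k::field \<Rightarrow> 'a::ab_group_add \<Rightarrow> 'a) \<Rightarrow> ('a \<Rightarrow> 'a \<Rightarrow> 'a) \<Rightarrow> 'a set \<Rightarrow> 'a set set" where
  "hereditary_saturated_sets scale mult B =
     {H \<in> hereditary_sets scale mult B. saturated (associated_graph scale mult B) H}"

definition ideals ::
    "('k::field \<Rightarrow> 'a::ab_group_add \<Rightarrow> 'a) \<Rightarrow> ('a \<Rightarrow> 'a \<Rightarrow> 'a) \<Rightarrow> 'a set set" where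
  "ideals scale mult = {I. algebra_ideal scale mult I}"

definition absorbing_ideals ::
    "('k::field \<Rightarrow> 'a::ab_group_add \<Rightarrow> 'a) \<Rightarrow> ('a \<Rightarrow> 'a \<Rightarrow> 'a) \<Rightarrow> 'a set set" where
  "absorbing_ideals scale mult = {I \<in> ideals scale mult. absorption mult I}"

definition ideal_of :: "('k::field \<Rightarrow> 'a::ab_group_add \<Rightarrow> 'a) \<Rightarrow> 'a set \<Rightarrow> 'a set" where
  "ideal_of scale H = module.span scale H"

text \<open>An intersection of subsets of \<open>B\<close> over an empty index set means \<open>B\<close>, not \<open>UNIV\<close>, so
  such intersections are written with an explicit \<open>B \<inter>\<close>.\<close>

definition hereditary_of :: "('a \<Rightarrow> 'a \<Rightarrow> 'a) \<Rightarrow> 'a set \<Rightarrow> 'a set \<Rightarrow> 'a set" where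
  "hereditary_of mult B I = {e \<in> B. mult e e \<in> I}"

definition inclusion_order :: "'a set set \<Rightarrow> 'a set gorder" where
  "inclusion_order X = \<lparr> carrier = X, eq = (=), le = (\<subseteq>) \<rparr>"

text \<open>\<open>f\<close> is the left adjoint. The locale predicate \<open>galois_connection\<close> also states that
  \<open>f\<close> maps \<open>carrier P\<close> into \<open>carrier Q\<close> and \<open>g\<close> maps \<open>carrier Q\<close> into \<open>carrier P\<close>.\<close>

definition monotone_galois_connection ::
    "'a gorder \<Rightarrow> 'b gorder \<Rightarrow> ('a \<Rightarrow> 'b) \<Rightarrow> ('b \<Rightarrow> 'a) \<Rightarrow> bool" where
  "monotone_galois_connection P Q f g \<longleftrightarrow>
     galois_connection \<lparr> orderA = P, orderB = Q, lower = f, upper = g \<rparr> \<and>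
     isotone P Q f \<and> isotone Q P g"

end

theory Submission
  imports Defs
begin

text \<open>Everything rests on one consequence of \<open>e e' = 0\<close>: multiplying by a basis vector \<open>e\<close> reads off
  one coordinate, \<open>a e = e a = a\<^sub>e e\<^sup>2\<close>, where \<open>a\<^sub>e\<close> is the coefficient of \<open>e\<close> in \<open>a\<close>
  (\<open>basis_mult\<close>, \<open>mult_basis\<close>). It follows that ideals are governed by the squares \<open>e\<^sup>2\<close>, and
  all graph notions become statements about spans. For \<open>H \<subseteq> B\<close>, heredity says
  \<open>e\<^sup>2 \<in> span H\<close> for all \<open>e \<in> H\<close> (\<open>hereditary_iff_squares\<close>), and saturation says that
  \<open>0 \<noteq> e\<^sup>2 \<in> span H\<close> forces \<open>e \<in> H\<close> (\<open>saturated_iff_squares\<close>), since a basis vector is a regular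
  vertex exactly when its square is nonzero. Absorption of a subspace \<open>I\<close> likewise says that \<open>e\<^sup>2 \<in> I\<close>
  forces \<open>e \<in> I\<close> (\<open>absorption_iff_squares\<close>).

  Non-degeneracy means that no \<open>e\<^sup>2\<close> vanishes, so \<open>H\<close> is saturated exactly when \<open>span H\<close> is
  absorbing (\<open>saturated_iff_absorption_span\<close>). For an absorbing ideal the set \<open>H\<^sub>I\<close> is just
  \<open>B \<inter> I\<close>, and the adjunction becomes the universal property of the span:
  \<open>span H \<subseteq> I\<close> if and only if \<open>H \<subseteq> I\<close>. The statements on unions and on intersections are
  formal.

  If \<open>A\<close> is finite-dimensional and \<open>A = A\<^sup>2\<close>, the squares of the basis vectors span \<open>A\<close>, so
  by counting they form a basis. For hereditary \<open>H\<close> the \<open>|H|\<close> independent vectors \<open>e\<^sup>2\<close> with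
  \<open>e \<in> H\<close> lie in \<open>span H\<close>, hence span it (\<open>hereditary_subset_span_squares\<close>). Applied to \<open>H\<^sub>I\<close>
  this gives \<open>H\<^sub>I \<subseteq> I\<close>: every ideal is absorbing. Consequently every hereditary set is
  saturated, and the last claim is the first one.\<close>

section \<open>Galois connections between families of sets\<close>

lemma monotone_galois_connection_inclusionI:
  assumes f: "f ` X \<subseteq> Y" and g: "g ` Y \<subseteq> X"
    and adjoint: "\<And>S T. \<lbrakk>S \<in> X; T \<in> Y\<rbrakk> \<Longrightarrow> f S \<subseteq> T \<longleftrightarrow> S \<subseteq> g T"
  shows "monotone_galois_connection (inclusion_order X) (inclusion_order Y) f g"
proof -
  have po: "partial_order (inclusion_order Z)" for Z :: "'z set set"
    by unfold_locales (auto simp: inclusion_order_def)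
  have gc: "galois_connection
      \<lparr>orderA = inclusion_order X, orderB = inclusion_order Y, lower = f, upper = g\<rparr>"
    by (intro galois_connection.intro connection.intro galois_connection_axioms.intro)
      (use f g adjoint po in \<open>auto simp: inclusion_order_def\<close>)
  show ?thesis
    using gc galois_connection.lower_iso[OF gc] galois_connection.upper_iso[OF gc]
    by (simp add: monotone_galois_connection_def)
qed

section \<open>Sums of spans\<close>

context vector_space
begin

lemma sum_of_family_span:
  "sum_of_family \<Gamma> (\<lambda>i. span (S i)) = span (\<Union>i\<in>\<Gamma>. S i)"
proof
  show "sum_of_family \<Gamma> (\<lambda>i. span (S i)) \<subseteq> span (\<Union>i\<in>\<Gamma>. S i)"
  proof
    fix y assume "y \<in> sum_of_family \<Gamma> (\<lambda>i. span (S i))"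
    then obtain F x where y: "y = sum x F" and F: "F \<subseteq> \<Gamma>" "\<And>i. i \<in> F \<Longrightarrow> x i \<in> span (S i)"
      unfolding sum_of_family_def by blast
    have "x i \<in> span (\<Union>i\<in>\<Gamma>. S i)" if "i \<in> F" for i
      using F that span_mono[of "S i" "\<Union>i\<in>\<Gamma>. S i"] by blast
    then show "y \<in> span (\<Union>i\<in>\<Gamma>. S i)"
      unfolding y by (rule span_sum)
  qed
  show "span (\<Union>i\<in>\<Gamma>. S i) \<subseteq> sum_of_family \<Gamma> (\<lambda>i. span (S i))"
  proof
    fix y assume "y \<in> span (\<Union>i\<in>\<Gamma>. S i)"
    then show "y \<in> sum_of_family \<Gamma> (\<lambda>i. span (S i))"
    proof (induction rule: span_induct_alt)
      case base
      show ?case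
        unfolding sum_of_family_def by (rule CollectI, rule exI[of _ "{}"]) simp
    next
      case (step c s y)
      then obtain F x j where F: "y = sum x F" "finite F" "F \<subseteq> \<Gamma>"
          "\<And>i. i \<in> F \<Longrightarrow> x i \<in> span (S i)" and j: "j \<in> \<Gamma>" "s \<in> S j"
        unfolding sum_of_family_def by blast
      \<comment> \<open>The new term is absorbed into the \<open>j\<close>-th summand, which is \<open>0\<close> if \<open>j\<close> did not occur yet.\<close>
      define x' where "x' = (\<lambda>i. if i = j then scale c s + (if j \<in> F then x j else 0) else x i)"
      have "sum x' (insert j F) = x' j + sum x' (F - {j})"
        using F(2) by (simp add: sum.insert_remove)
      also have "sum x' (F - {j}) = sum x (F - {j})"
        by (rule sum.cong) (auto simp: x'_def)
      also have "x' j + sum x (F - {j}) = scale c s + y"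
        using F(1,2) by (auto simp: x'_def sum.remove[of F j] add.assoc)
      finally have "scale c s + y = sum x' (insert j F)" ..
      moreover have "\<forall>i\<in>insert j F. x' i \<in> span (S i)"
        using F(4) j(2) by (auto simp: x'_def intro: span_add span_scale span_base)
      ultimately show ?case
        unfolding sum_of_family_def using F(2,3) j(1)
        by (intro CollectI exI[of _ "insert j F"] exI[of _ x']) auto
    qed
  qed
qed

end

section \<open>Coordinates in an evolution algebra\<close>

context evolution_algebra
begin

abbreviation coordinate :: "'a \<Rightarrow> 'a \<Rightarrow> 'k" where
  "coordinate \<equiv> representation B"

abbreviation graph :: "('a, 'a \<times> 'a) pre_digraph" where
  "graph \<equiv> associated_graph (*s) (\<bullet>) B"

lemma module_hom_mult_right: "module_hom (*s) (*s) (\<lambda>y. x \<bullet> y)"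
  using linear_mult_right[of x] by (simp add: Vector_Spaces.linear_iff_module_hom)

lemma module_hom_mult_left: "module_hom (*s) (*s) (\<lambda>x. x \<bullet> y)"
  using linear_mult_left[of y] by (simp add: Vector_Spaces.linear_iff_module_hom)

lemmas mult_right_linear =
  module_hom.add[OF module_hom_mult_right] module_hom.scale[OF module_hom_mult_right]
  module_hom.zero[OF module_hom_mult_right]

lemmas mult_left_linear =
  module_hom.add[OF module_hom_mult_left] module_hom.scale[OF module_hom_mult_left]
  module_hom.zero[OF module_hom_mult_left]

lemma mem_span_basis [simp]: "x \<in> span B"
  by (simp add: span_basis)

lemma coordinate_add [simp]: "coordinate (x + y) b = coordinate x b + coordinate y b"
  by (simp add: representation_add independent_basis)

lemma coordinate_scale [simp]: "coordinate (c *s x) b = c * coordinate x b"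
  by (simp add: representation_scale independent_basis)

lemma coordinate_zero [simp]: "coordinate 0 b = 0"
  by (simp add: representation_zero)

lemma coordinate_basis: "e \<in> B \<Longrightarrow> coordinate e b = (if b = e then 1 else 0)"
  by (simp add: representation_basis independent_basis)

lemma mem_span_iff_coordinates:
  assumes "H \<subseteq> B"
  shows "x \<in> span H \<longleftrightarrow> (\<forall>b. coordinate x b \<noteq> 0 \<longrightarrow> b \<in> H)"
proof
  assume "x \<in> span H"
  then have "coordinate x = representation H x"
    using assms by (intro representation_extend independent_basis)
  then show "\<forall>b. coordinate x b \<noteq> 0 \<longrightarrow> b \<in> H"
    by (auto dest: representation_ne_zero)
next
  assume *: "\<forall>b. coordinate x b \<noteq> 0 \<longrightarrow> b \<in> H"
  have "(\<Sum>b | coordinate x b \<noteq> 0. coordinate x b *s b) \<in> span H"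
    using * by (intro span_sum span_scale span_base) auto
  then show "x \<in> span H"
    by (simp add: sum_nonzero_representation_eq independent_basis)
qed

lemma basis_mem_span_iff: "H \<subseteq> B \<Longrightarrow> e \<in> B \<Longrightarrow> e \<in> span H \<longleftrightarrow> e \<in> H"
  by (simp add: mem_span_iff_coordinates coordinate_basis)

text \<open>All products of \<open>e\<close> with the other basis vectors vanish, so only the \<open>e\<close>-term of \<open>a\<close> contributes.\<close>

lemma basis_mult:
  assumes e: "e \<in> B"
  shows "e \<bullet> a = coordinate a e *s (e \<bullet> e)"
  using mem_span_basis[of a]
proof (induction a rule: span_induct_alt)
  case base
  show ?case by (simp add: mult_right_linear)
next
  case (step c b y)
  then show ?case
    using natural_basis[OF e, of b]
    by (auto simp: mult_right_linear coordinate_basis scale_left_distrib)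
qed

lemma mult_basis:
  assumes e: "e \<in> B"
  shows "a \<bullet> e = coordinate a e *s (e \<bullet> e)"
  using mem_span_basis[of a]
proof (induction a rule: span_induct_alt)
  case base
  show ?case by (simp add: mult_left_linear)
next
  case (step c b y)
  then show ?case
    using natural_basis[OF _ e, of b]
    by (auto simp: mult_left_linear coordinate_basis scale_left_distrib)
qed

lemma basis_square_nonzero:
  assumes "nondegenerate (\<bullet>)" "e \<in> B"
  shows "e \<bullet> e \<noteq> 0"
proof
  assume "e \<bullet> e = 0"
  then have "e \<bullet> a = 0" for a
    by (subst basis_mult[OF assms(2)]) simp
  then have "e = 0"
    using assms(1) unfolding nondegenerate_def by blast
  then show False
    using assms(2) independent_basis dependent_zero by blast
qed

section \<open>Graph notions and absorption in terms of squares\<close>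

lemma verts_graph [simp]: "verts graph = B"
  by (simp add: associated_graph_def)

lemma arcs_ends_graph:
  "u \<rightarrow>\<^bsub>graph\<^esub> v \<longleftrightarrow> u \<in> B \<and> v \<in> B \<and> coordinate (u \<bullet> u) v \<noteq> 0"
  by (force simp: arcs_ends_def arc_to_ends_def associated_graph_def)

lemma head_out_arcs_graph:
  "u \<in> B \<Longrightarrow> head graph ` out_arcs graph u = {v. coordinate (u \<bullet> u) v \<noteq> 0}"
  by (force simp: out_arcs_def associated_graph_def dest: representation_ne_zero)

lemma hereditary_iff_squares:
  "hereditary graph H \<longleftrightarrow> H \<subseteq> B \<and> (\<forall>e\<in>H. e \<bullet> e \<in> span H)"
proof
  assume H: "hereditary graph H"
  then have sub: "H \<subseteq> B"
    by (simp add: hereditary_def)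
  have "v \<in> H" if "e \<in> H" "coordinate (e \<bullet> e) v \<noteq> 0" for e v
  proof -
    have "v \<in> B"
      using that(2) by (rule representation_ne_zero)
    then have "(e, v) \<in> rtrancl_on B (arcs_ends graph)"
      using that sub
      by (intro converse_rtrancl_on_into_rtrancl_on[of e v]) (auto simp: arcs_ends_graph)
    then show ?thesis
      using H that(1) by (auto simp: hereditary_def reachable_def)
  qed
  then show "H \<subseteq> B \<and> (\<forall>e\<in>H. e \<bullet> e \<in> span H)"
    using sub by (simp add: mem_span_iff_coordinates)
next
  assume H: "H \<subseteq> B \<and> (\<forall>e\<in>H. e \<bullet> e \<in> span H)"
  have "v \<in> H" if "u \<rightarrow>\<^sup>*\<^bsub>graph\<^esub> v" "u \<in> H" for u v
    using that unfolding reachable_def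
  proof (induction rule: rtrancl_on_induct)
    case base
    then show ?case by simp
  next
    case (step y z)
    then show ?case
      using H by (auto simp: arcs_ends_graph mem_span_iff_coordinates)
  qed
  then show "hereditary graph H"
    using H by (simp add: hereditary_def)
qed

text \<open>The squares have finite support, so no vertex is an infinite emitter and regularity only asks for
  an outgoing edge.\<close>

lemma regular_vertex_iff: "regular_vertex graph u \<longleftrightarrow> u \<in> B \<and> u \<bullet> u \<noteq> 0"
proof (cases "u \<in> B")
  case True
  have "out_arcs graph u = Pair u ` {v. coordinate (u \<bullet> u) v \<noteq> 0}"
    using True by (auto simp: out_arcs_def associated_graph_def dest: representation_ne_zero)
  moreover have "{v. coordinate (u \<bullet> u) v \<noteq> 0} \<noteq> {} \<longleftrightarrow> u \<bullet> u \<noteq> 0"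
    using mem_span_iff_coordinates[of "{}" "u \<bullet> u"] by auto
  ultimately show ?thesis
    using True finite_representation[of B "u \<bullet> u"] by (simp add: regular_vertex_def)
next
  case False
  then show ?thesis by (simp add: regular_vertex_def)
qed

lemma saturated_iff_squares:
  assumes "H \<subseteq> B"
  shows "saturated graph H \<longleftrightarrow> (\<forall>u\<in>B. u \<bullet> u \<noteq> 0 \<longrightarrow> u \<bullet> u \<in> span H \<longrightarrow> u \<in> H)"
proof -
  have "head graph ` out_arcs graph u \<subseteq> H \<longleftrightarrow> u \<bullet> u \<in> span H" if "u \<in> B" for u
    unfolding head_out_arcs_graph[OF that] mem_span_iff_coordinates[OF assms] by blast
  then show ?thesis
    unfolding saturated_def regular_vertex_iff by blast
qed

text \<open>If \<open>x A \<subseteq> I\<close>, then \<open>x e \<in> I\<close> puts \<open>e\<^sup>2\<close> into \<open>I\<close> for every \<open>e\<close> in the support of \<open>x\<close>; conversely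
  \<open>e A\<close> is spanned by \<open>e\<^sup>2\<close>.\<close>

lemma absorption_iff_squares:
  assumes I: "subspace I"
  shows "absorption (\<bullet>) I \<longleftrightarrow> hereditary_of (\<bullet>) B I \<subseteq> I"
proof
  assume abs: "absorption (\<bullet>) I"
  show "hereditary_of (\<bullet>) B I \<subseteq> I"
  proof
    fix e assume "e \<in> hereditary_of (\<bullet>) B I"
    then have e: "e \<in> B" "e \<bullet> e \<in> I"
      by (auto simp: hereditary_of_def)
    have "e \<bullet> a \<in> I" for a
      using subspace_scale[OF I e(2)] by (subst basis_mult[OF e(1)])
    then show "e \<in> I"
      using abs unfolding absorption_def by blast
  qed
next
  assume sub: "hereditary_of (\<bullet>) B I \<subseteq> I"
  show "absorption (\<bullet>) I"
    unfolding absorption_def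
  proof (intro allI impI)
    fix x assume x: "range ((\<bullet>) x) \<subseteq> I"
    have "e \<in> I" if "coordinate x e \<noteq> 0" for e
    proof -
      have e: "e \<in> B"
        using that by (rule representation_ne_zero)
      have "coordinate x e *s (e \<bullet> e) \<in> I"
        using x mult_basis[OF e, of x] by (metis range_subsetD)
      then have "e \<bullet> e \<in> I"
        using subspace_scale[OF I, of _ "inverse (coordinate x e)"] that by fastforce
      then show ?thesis
        using sub e by (auto simp: hereditary_of_def)
    qed
    then have "(\<Sum>b | coordinate x b \<noteq> 0. coordinate x b *s b) \<in> I"
      by (intro subspace_sum[OF I] subspace_scale[OF I]) auto
    then show "x \<in> I"
      by (simp add: sum_nonzero_representation_eq independent_basis)
  qed
qed

lemma saturated_iff_absorption_span:
  assumes "nondegenerate (\<bullet>)" "H \<subseteq> B"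
  shows "saturated graph H \<longleftrightarrow> absorption (\<bullet>) (span H)"
proof -
  have "hereditary_of (\<bullet>) B (span H) \<subseteq> span H \<longleftrightarrow> (\<forall>u\<in>B. u \<bullet> u \<in> span H \<longrightarrow> u \<in> H)"
    using basis_mem_span_iff[OF assms(2)] unfolding hereditary_of_def by blast
  then show ?thesis
    using basis_square_nonzero[OF assms(1)]
    unfolding saturated_iff_squares[OF assms(2)] absorption_iff_squares[OF subspace_span] by blast
qed

section \<open>The two maps\<close>

lemma algebra_ideal_span_hereditary:
  assumes "hereditary graph H"
  shows "algebra_ideal (*s) (\<bullet>) (span H)"
proof -
  have H: "e \<in> B" "e \<bullet> e \<in> span H" if "e \<in> H" for e
    using assms that by (auto simp: hereditary_iff_squares)
  have "x \<bullet> a \<in> span H \<and> a \<bullet> x \<in> span H" if "x \<in> span H" for x a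
    using that
  proof (induction x rule: span_induct_alt)
    case base
    show ?case by (simp add: mult_left_linear mult_right_linear span_zero)
  next
    case (step c e y)
    have "e \<bullet> a \<in> span H" "a \<bullet> e \<in> span H"
      using H[OF step(1)] by (auto simp: basis_mult[of e a] mult_basis[of e a] intro: span_scale)
    then show ?case
      using step by (simp add: mult_left_linear mult_right_linear span_add span_scale)
  qed
  then show ?thesis
    by (simp add: algebra_ideal_def)
qed

text \<open>An edge from \<open>e\<close> to \<open>b\<close> means that \<open>e\<^sup>2\<close> has a nonzero \<open>b\<close>-coordinate, so the product
  \<open>b e\<^sup>2\<close>, which is in \<open>I\<close> along with \<open>e\<^sup>2\<close>, is \<open>b\<^sup>2\<close> times an invertible scalar.\<close>

lemma hereditary_hereditary_of:
  assumes I: "algebra_ideal (*s) (\<bullet>) I"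
  shows "hereditary graph (hereditary_of (\<bullet>) B I)"
proof -
  have sub: "subspace I"
    using I by (simp add: algebra_ideal_def)
  have "b \<bullet> b \<in> I" "b \<in> B" if "e \<bullet> e \<in> I" "coordinate (e \<bullet> e) b \<noteq> 0" for e b
  proof -
    show b: "b \<in> B"
      using that(2) by (rule representation_ne_zero)
    have "coordinate (e \<bullet> e) b *s (b \<bullet> b) \<in> I"
      using I that(1) basis_mult[OF b, of "e \<bullet> e"] unfolding algebra_ideal_def by metis
    then show "b \<bullet> b \<in> I"
      using subspace_scale[OF sub, of _ "inverse (coordinate (e \<bullet> e) b)"] that(2) by fastforce
  qed
  moreover have "hereditary_of (\<bullet>) B I \<subseteq> B"
    by (auto simp: hereditary_of_def)
  ultimately show ?thesis
    by (auto simp: hereditary_iff_squares mem_span_iff_coordinates) (auto simp: hereditary_of_def)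
qed

lemma hereditary_of_absorbing:
  assumes "algebra_ideal (*s) (\<bullet>) I" "absorption (\<bullet>) I"
  shows "hereditary_of (\<bullet>) B I = B \<inter> I"
proof -
  have "hereditary_of (\<bullet>) B I \<subseteq> I"
    using assms absorption_iff_squares by (simp add: algebra_ideal_def)
  moreover have "e \<bullet> e \<in> I" if "e \<in> I" for e
    using assms(1) that by (simp add: algebra_ideal_def)
  ultimately show ?thesis
    by (auto simp: hereditary_of_def)
qed

lemma saturated_hereditary_of:
  assumes "algebra_ideal (*s) (\<bullet>) I" "absorption (\<bullet>) I"
  shows "saturated graph (hereditary_of (\<bullet>) B I)"
proof -
  have "span (hereditary_of (\<bullet>) B I) \<subseteq> I"
    using assms by (intro span_minimal) (auto simp: hereditary_of_absorbing algebra_ideal_def)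
  then show ?thesis
    by (subst saturated_iff_squares) (auto simp: hereditary_of_def)
qed

lemma galois_connection_saturated_absorbing:
  assumes "nondegenerate (\<bullet>)"
  shows "monotone_galois_connection
    (inclusion_order (hereditary_saturated_sets (*s) (\<bullet>) B))
    (inclusion_order (absorbing_ideals (*s) (\<bullet>)))
    (ideal_of (*s)) (hereditary_of (\<bullet>) B)"
proof (rule monotone_galois_connection_inclusionI)
  show "ideal_of (*s) ` hereditary_saturated_sets (*s) (\<bullet>) B \<subseteq> absorbing_ideals (*s) (\<bullet>)"
    using saturated_iff_absorption_span[OF assms] algebra_ideal_span_hereditary
    by (auto simp: hereditary_saturated_sets_def hereditary_sets_def absorbing_ideals_def
        ideals_def ideal_of_def hereditary_iff_squares)
  show "hereditary_of (\<bullet>) B ` absorbing_ideals (*s) (\<bullet>) \<subseteq> hereditary_saturated_sets (*s) (\<bullet>) B"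
    by (auto simp: hereditary_saturated_sets_def hereditary_sets_def absorbing_ideals_def
        ideals_def hereditary_hereditary_of saturated_hereditary_of)
  fix H I
  assume "H \<in> hereditary_saturated_sets (*s) (\<bullet>) B" "I \<in> absorbing_ideals (*s) (\<bullet>)"
  then have "H \<subseteq> B" "algebra_ideal (*s) (\<bullet>) I" "absorption (\<bullet>) I"
    by (auto simp: hereditary_saturated_sets_def hereditary_sets_def absorbing_ideals_def
        ideals_def hereditary_iff_squares)
  moreover from this have "span H \<subseteq> I \<longleftrightarrow> H \<subseteq> I"
    using span_minimal[of H I] span_superset[of H] by (auto simp: algebra_ideal_def)
  ultimately show "ideal_of (*s) H \<subseteq> I \<longleftrightarrow> H \<subseteq> hereditary_of (\<bullet>) B I"
    by (auto simp: ideal_of_def hereditary_of_absorbing)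
qed

section \<open>Perfect algebras of finite dimension\<close>

lemma algebra_square_eq_span_squares:
  "algebra_square (*s) (\<bullet>) = span ((\<lambda>e. e \<bullet> e) ` B)"
proof
  have "x \<bullet> y \<in> span ((\<lambda>e. e \<bullet> e) ` B)" for x y
    using mem_span_basis[of x]
  proof (induction x rule: span_induct_alt)
    case base
    show ?case by (simp add: mult_left_linear span_zero)
  next
    case (step c e z)
    then have "e \<bullet> y \<in> span ((\<lambda>e. e \<bullet> e) ` B)"
      by (subst basis_mult) (auto intro: span_scale span_base)
    with step show ?case
      by (simp add: mult_left_linear span_add span_scale)
  qed
  then show "algebra_square (*s) (\<bullet>) \<subseteq> span ((\<lambda>e. e \<bullet> e) ` B)"
    unfolding algebra_square_def by (intro span_minimal) auto
  show "span ((\<lambda>e. e \<bullet> e) ` B) \<subseteq> algebra_square (*s) (\<bullet>)"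
    unfolding algebra_square_def by (intro span_mono) auto
qed

lemma finite_basis:
  assumes "finite_dimensional (*s)"
  shows "finite B"
  using assms independent_span_bound[OF _ independent_basis]
  unfolding finite_dimensional_def by auto

text \<open>A spanning family of \<open>dim A\<close> vectors cannot have repetitions or relations: a basis extracted
  from it already has \<open>dim A\<close> elements.\<close>

lemma squares_basis:
  assumes fin: "finite B" and perfect: "algebra_square (*s) (\<bullet>) = UNIV"
  shows "inj_on (\<lambda>e. e \<bullet> e) B" "independent ((\<lambda>e. e \<bullet> e) ` B)"
proof -
  let ?Q = "(\<lambda>e. e \<bullet> e) ` B"
  have span: "span ?Q = UNIV"
    using perfect by (simp add: algebra_square_eq_span_squares)
  obtain C where C: "C \<subseteq> ?Q" "independent C" "?Q \<subseteq> span C"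
    using maximal_independent_subset[of ?Q] by blast
  then have "span C = UNIV"
    using span span_minimal[OF C(3)] by auto
  moreover have finC: "finite C"
    using C(1) fin by (auto intro: finite_subset)
  ultimately have "card B \<le> card C"
    using independent_span_bound[OF _ independent_basis, of C] by auto
  moreover have "card C \<le> card ?Q"
    using C(1) fin by (intro card_mono) auto
  moreover have "card ?Q \<le> card B"
    using fin by (rule card_image_le)
  ultimately have eq: "card C = card ?Q" "card ?Q = card B"
    by auto
  show "inj_on (\<lambda>e. e \<bullet> e) B"
    using eq(2) fin by (intro eq_card_imp_inj_on)
  have "C = ?Q"
    using C(1) eq(1) fin by (intro card_subset_eq) auto
  with C(2) show "independent ?Q" by simp
qed

lemma hereditary_subset_span_squares:
  assumes fin: "finite B" and perfect: "algebra_square (*s) (\<bullet>) = UNIV"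
    and H: "hereditary graph H"
  shows "H \<subseteq> span ((\<lambda>e. e \<bullet> e) ` H)"
proof
  let ?Q = "(\<lambda>e. e \<bullet> e) ` H"
  fix h assume h: "h \<in> H"
  have sub: "H \<subseteq> B" "?Q \<subseteq> span H"
    using H by (auto simp: hereditary_iff_squares)
  have finH: "finite H"
    using sub(1) fin by (rule finite_subset)
  have card: "card ?Q = card H"
    using squares_basis(1)[OF fin perfect] sub(1) by (intro card_image) (rule inj_on_subset)
  have ind: "independent ?Q"
    using squares_basis(2)[OF fin perfect] sub(1) by (rule independent_mono[OF _ image_mono])
  show "h \<in> span ?Q"
  proof (rule ccontr)
    \<comment> \<open>Otherwise \<open>span H\<close> would contain \<open>card H + 1\<close> independent vectors.\<close>
    assume h': "h \<notin> span ?Q"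
    then have "independent (insert h ?Q)"
      by (rule independent_insertI[OF _ ind])
    moreover have "insert h ?Q \<subseteq> span H"
      using sub(2) h by (auto intro: span_base)
    ultimately have "card (insert h ?Q) \<le> card H"
      using independent_span_bound[OF finH] by blast
    moreover have "h \<notin> ?Q"
      using h' span_base[of h ?Q] by blast
    ultimately show False
      using card finH by simp
  qed
qed

text \<open>The hereditary set \<open>H\<^sub>I\<close> lies in the span of its own squares, which are elements of \<open>I\<close> by
  definition of \<open>H\<^sub>I\<close>.\<close>

lemma absorption_of_perfect:
  assumes "finite B" "algebra_square (*s) (\<bullet>) = UNIV" and I: "algebra_ideal (*s) (\<bullet>) I"
  shows "absorption (\<bullet>) I"
proof -
  let ?H = "hereditary_of (\<bullet>) B I"
  have sub: "subspace I"
    using I by (simp add: algebra_ideal_def)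
  have "?H \<subseteq> span ((\<lambda>e. e \<bullet> e) ` ?H)"
    using assms hereditary_hereditary_of by (intro hereditary_subset_span_squares)
  also have "\<dots> \<subseteq> I"
    using sub by (intro span_minimal) (auto simp: hereditary_of_def)
  finally show ?thesis
    using absorption_iff_squares[OF sub] by simp
qed

lemma perfect_families_coincide:
  assumes "nondegenerate (\<bullet>)" "finite B" "algebra_square (*s) (\<bullet>) = UNIV"
  shows "absorbing_ideals (*s) (\<bullet>) = ideals (*s) (\<bullet>)"
    and "hereditary_saturated_sets (*s) (\<bullet>) B = hereditary_sets (*s) (\<bullet>) B"
proof -
  show "absorbing_ideals (*s) (\<bullet>) = ideals (*s) (\<bullet>)"
    using absorption_of_perfect[OF assms(2,3)] by (auto simp: absorbing_ideals_def ideals_def)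
  have "saturated graph H" if H: "hereditary graph H" for H
    using saturated_iff_absorption_span[OF assms(1), of H] H
      absorption_of_perfect[OF assms(2,3) algebra_ideal_span_hereditary[OF H]]
    by (simp add: hereditary_iff_squares)
  then show "hereditary_saturated_sets (*s) (\<bullet>) B = hereditary_sets (*s) (\<bullet>) B"
    by (auto simp: hereditary_saturated_sets_def hereditary_sets_def)
qed

end

section \<open>The Galois connections and their consequences\<close>

theorem theorem5p14:
  fixes scale :: "'k::field \<Rightarrow> 'a::ab_group_add \<Rightarrow> 'a"
    and mult :: "'a \<Rightarrow> 'a \<Rightarrow> 'a"
    and B :: "'a set"
  assumes "evolution_algebra scale mult B"
    and "nondegenerate mult"
  shows "(monotone_galois_connection
           (inclusion_order (hereditary_saturated_sets scale mult B))
           (inclusion_order (absorbing_ideals scale mult))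
           (ideal_of scale) (hereditary_of mult B)) \<and>
         (\<forall>(\<Gamma> :: 'i set) H.
           (\<forall>i\<in>\<Gamma>. H i \<in> hereditary_saturated_sets scale mult B) \<longrightarrow>
           (\<Union>i\<in>\<Gamma>. H i) \<in> hereditary_saturated_sets scale mult B \<longrightarrow>
           ideal_of scale (\<Union>i\<in>\<Gamma>. H i) = sum_of_family \<Gamma> (\<lambda>i. ideal_of scale (H i))) \<and>
         (\<forall>(\<Omega> :: 'j set) I.
           (\<forall>i\<in>\<Omega>. I i \<in> absorbing_ideals scale mult) \<longrightarrow>
           hereditary_of mult B (\<Inter>i\<in>\<Omega>. I i) = B \<inter> (\<Inter>i\<in>\<Omega>. hereditary_of mult B (I i))) \<and>
         (finite_dimensional scale \<longrightarrow> algebra_square scale mult = UNIV \<longrightarrow>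
         monotone_galois_connection
           (inclusion_order (hereditary_sets scale mult B))
           (inclusion_order (ideals scale mult))
           (ideal_of scale) (hereditary_of mult B))"
proof -
  interpret evolution_algebra scale mult B by fact
  show ?thesis
  proof (intro conjI allI impI)
    show galois: "monotone_galois_connection
        (inclusion_order (hereditary_saturated_sets scale mult B))
        (inclusion_order (absorbing_ideals scale mult))
        (ideal_of scale) (hereditary_of mult B)"
      using assms(2) by (rule galois_connection_saturated_absorbing)
    show "ideal_of scale (\<Union>i\<in>\<Gamma>. H i) = sum_of_family \<Gamma> (\<lambda>i. ideal_of scale (H i))"
      for \<Gamma> :: "'i set" and H
      by (simp add: ideal_of_def sum_of_family_span)
    show "hereditary_of mult B (\<Inter>i\<in>\<Omega>. I i) = B \<inter> (\<Inter>i\<in>\<Omega>. hereditary_of mult B (I i))"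
      for \<Omega> :: "'j set" and I
      by (auto simp: hereditary_of_def)
    show "monotone_galois_connection
        (inclusion_order (hereditary_sets scale mult B))
        (inclusion_order (ideals scale mult))
        (ideal_of scale) (hereditary_of mult B)"
      if "finite_dimensional scale" "algebra_square scale mult = UNIV"
      using galois perfect_families_coincide[OF assms(2) finite_basis[OF that(1)] that(2)] by simp
  qed
qed

end
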